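(* A sequence $\{a_n\}_{n=1}^{\infty}$ in $\mathbb{R}$ converges if and only if $\{a_n\}_{n=1}^{\infty}$ is bounded and half Cauchy.
   Context: A sequence $\{a_n\}_{n=1}^{\infty}$ in $\mathbb{R}$ is upward half Cauchy if for every $\epsilon > 0$ there exists $N \in \mathbb{N}$ such that for all $n \geq m \geq N$, $a_m - a_n < \epsilon$. It is downward half Cauchy if for every $\epsilon > 0$ there exists $N \in \mathbb{N}$ such that for all $n \geq m \geq N$, $a_n - a_m < \epsilon$. It is half Cauchy if it is either upward half Cauchy, or downward half Cauchy, or both. Convergence means convergence to a (finite) limit in $\mathbb{R}$. *)

theory Defs
  imports "HOL-Analysis.Analysis"
begin

text \<open>Sequences are functions on \<^typ>\<open>nat\<close>, so the first term has index 0 instead of 1.\<close>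

definition upward_half_Cauchy :: "(nat \<Rightarrow> real) \<Rightarrow> bool" where
  "upward_half_Cauchy a \<longleftrightarrow>
     (\<forall>\<epsilon>>0. \<exists>N. \<forall>m n. n \<ge> m \<and> m \<ge> N \<longrightarrow> a m - a n < \<epsilon>)"

definition downward_half_Cauchy :: "(nat \<Rightarrow> real) \<Rightarrow> bool" where
  "downward_half_Cauchy a \<longleftrightarrow>
     (\<forall>\<epsilon>>0. \<exists>N. \<forall>m n. n \<ge> m \<and> m \<ge> N \<longrightarrow> a n - a m < \<epsilon>)"

definition half_Cauchy :: "(nat \<Rightarrow> real) \<Rightarrow> bool" where
  "half_Cauchy a \<longleftrightarrow> upward_half_Cauchy a \<or> downward_half_Cauchy a"

end

theory Submission
  imports Defs
begin

text \<open>
  A convergent sequence is Cauchy, and the Cauchy condition bounds both \<open>a m - a n\<close> and its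
  negative. Conversely, a bounded sequence has a subsequence \<open>a (r k)\<close> that tends to some \<open>L\<close>.
  If the sequence is upward half Cauchy, it eventually drops by at most \<open>\<epsilon>\<close>. A late
  term \<open>a n\<close> is therefore trapped: it lies at most \<open>\<epsilon>\<close> below an earlier term of the subsequence and
  at most \<open>\<epsilon>\<close> above a later one, and both of these are close to \<open>L\<close>. Negation exchanges the two
  half Cauchy conditions, which settles the downward case.
\<close>

lemma downward_half_Cauchy_iff_uminus:
  "downward_half_Cauchy a \<longleftrightarrow> upward_half_Cauchy (\<lambda>n. - a n)"
  unfolding downward_half_Cauchy_def upward_half_Cauchy_def by simp

text \<open>
  One-sided control suffices because every index lies between two indices of the subsequence:
  the earlier one gives the lower bound for the distance to its limit, the later one the upper bound.
\<close>

lemma upward_half_Cauchy_subseq_tendsto: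
  assumes up: "upward_half_Cauchy a"
    and r: "strict_mono r"
    and lim: "(\<lambda>k. a (r k)) \<longlonglongrightarrow> L"
  shows "a \<longlonglongrightarrow> L"
proof (rule LIMSEQ_I)
  fix \<epsilon> :: real
  assume "\<epsilon> > 0"
  then have half: "\<epsilon> / 2 > 0" by simp
  obtain N where N: "\<And>m n. n \<ge> m \<Longrightarrow> m \<ge> N \<Longrightarrow> a m - a n < \<epsilon> / 2"
    using up half unfolding upward_half_Cauchy_def by blast
  obtain K where K: "\<And>k. k \<ge> K \<Longrightarrow> \<bar>a (r k) - L\<bar> < \<epsilon> / 2"
    using LIMSEQ_D[OF lim half] by (metis real_norm_def)
  define k where "k = max K N"
  have r_ge: "i \<le> r i" for i
    using r by (rule strict_mono_imp_increasing)
  have "\<bar>a n - L\<bar> < \<epsilon>" if n: "n \<ge> r k" for n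
  proof -
    have "r k \<ge> N" "n \<ge> N" "n \<ge> K"
      using r_ge[of k] n by (auto simp: k_def)
    have "a (r k) - a n < \<epsilon> / 2"
      using N n \<open>r k \<ge> N\<close> by blast
    moreover have "a n - a (r n) < \<epsilon> / 2"
      using N r_ge \<open>n \<ge> N\<close> by blast
    moreover have "\<bar>a (r k) - L\<bar> < \<epsilon> / 2" "\<bar>a (r n) - L\<bar> < \<epsilon> / 2"
      using K \<open>n \<ge> K\<close> by (auto simp: k_def)
    ultimately show ?thesis by linarith
  qed
  then show "\<exists>n0. \<forall>n\<ge>n0. norm (a n - L) < \<epsilon>" by auto
qed

lemma bounded_upward_half_Cauchy_imp_convergent:
  assumes "bounded (range a)" "upward_half_Cauchy a"
  shows "convergent a"
proof -
  obtain L r where "strict_mono r" "(a \<circ> r) \<longlonglongrightarrow> L"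
    using bounded_imp_convergent_subsequence[OF assms(1)] by blast
  then have "a \<longlonglongrightarrow> L"
    using upward_half_Cauchy_subseq_tendsto[OF assms(2)] by (simp add: o_def)
  then show ?thesis by (rule convergentI)
qed

lemma Cauchy_imp_upward_half_Cauchy:
  fixes a :: "nat \<Rightarrow> real"
  assumes "Cauchy a"
  shows "upward_half_Cauchy a"
  unfolding upward_half_Cauchy_def
proof (intro allI impI)
  fix \<epsilon> :: real
  assume "\<epsilon> > 0"
  then obtain N where N: "\<And>m n. m \<ge> N \<Longrightarrow> n \<ge> N \<Longrightarrow> norm (a m - a n) < \<epsilon>"
    using CauchyD[OF assms] by blast
  have "a m - a n < \<epsilon>" if "n \<ge> m \<and> m \<ge> N" for m n
    using N[of m n] that by simp
  then show "\<exists>N. \<forall>m n. n \<ge> m \<and> m \<ge> N \<longrightarrow> a m - a n < \<epsilon>" by blast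
qed

theorem theorem4:
  fixes a :: "nat \<Rightarrow> real"
  shows "convergent a \<longleftrightarrow> bounded (range a) \<and> half_Cauchy a"
proof
  assume "convergent a"
  then have "Cauchy a" by (rule convergent_Cauchy)
  then show "bounded (range a) \<and> half_Cauchy a"
    using cauchy_imp_bounded Cauchy_imp_upward_half_Cauchy
    unfolding half_Cauchy_def by blast
next
  assume bd: "bounded (range a) \<and> half_Cauchy a"
  then consider "upward_half_Cauchy a" | "downward_half_Cauchy a"
    unfolding half_Cauchy_def by blast
  then show "convergent a"
  proof cases
    case 1
    then show ?thesis
      using bd bounded_upward_half_Cauchy_imp_convergent by blast
  next
    case 2
    have "bounded (range (\<lambda>n. - a n))"
      using bd by (simp add: bounded_iff)
    then have "convergent (\<lambda>n. - a n)"
      using 2 bounded_upward_half_Cauchy_imp_convergent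
      unfolding downward_half_Cauchy_iff_uminus by blast
    then show ?thesis
      using convergent_minus_iff by blast
  qed
qed

end
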